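(* Let $\mathcal{R}$ be the Racah algebra, let $z_0,z_1,z_2,z_3,z_4$ be complex parameters, and define in $\mathcal{R}$ $$A=z_0+z_1R_1+z_2R_2+2R_3,\qquad B=z_3+\frac{z_1(z_1+z_4)}{2}R_1+\frac{z_2(z_2+z_4)}{2}R_2+z_4R_3+2\{R_1,R_2\}.$$ Then, with $a_0=-6$, $a'_0=-2$ and suitable $a_1,a_2,a_3,a_4,a_5,a_6,a_8,a_9$ that are polynomial functions of $z_0,z_1,z_2,z_3,z_4$ and of the central elements $d,e_1,e_2,\Gamma$, the elements $A$, $B$ and $C=[A,B]$ satisfy $$[A,C]=a_0B^2+a_1\{A,B\}+a_2A^2+a_4B+a_5A+a_8,$$ $$[B,C]=a'_0A^3-a_1B^2-a_2\{A,B\}+a_3A^2-a_5B+a_6A+a_9.$$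
   Context: $[x,y]=xy-yx$ and $\{x,y\}=xy+yx$. The Racah algebra $\mathcal{R}$ is the associative unital complex algebra generated by $R_1,R_2,R_3$ and $d,e_1,e_2,\Gamma$ with defining relations: $d,e_1,e_2,\Gamma$ are central, and $$[R_1,R_2]=R_3,$$ $$[R_3,R_1]=R_1^2+\{R_1,R_2\}+dR_1+e_2,$$ $$[R_2,R_3]=R_2^2+\{R_1,R_2\}+dR_2+e_1,$$ $$\Gamma=\{R_1^2,R_2\}+\{R_1,R_2^2\}+R_1^2+R_2^2+R_3^2+(d+1)\{R_1,R_2\}+(2e_1+d)R_1+(2e_2+d)R_2.$$ *)

theory Defs
  imports Complex_Main "HOL-Library.Poly_Mapping"
begin

definition commutator :: "'a::ring_1 \<Rightarrow> 'a \<Rightarrow> 'a" where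
  "commutator x y = x * y - y * x"

definition anticommutator :: "'a::ring_1 \<Rightarrow> 'a \<Rightarrow> 'a" where
  "anticommutator x y = x * y + y * x"


section \<open>Free associative algebras and two-sided ideals\<close>

text \<open>
  The free monoid, written additively (and not commutative) so that
  finitely supported complex-valued functions on it, with the convolution product of
  \<^theory>\<open>HOL-Library.Poly_Mapping\<close>, is the free unital associative complex algebra.
\<close>

datatype 'g free_monoid = Word (letters: "'g list")

instantiation free_monoid :: (type) monoid_add
begin

definition "0 = Word []"

definition "u + v = Word (letters u @ letters v)"

instance
  by standard (simp_all add: zero_free_monoid_def plus_free_monoid_def)

end

lemma free_monoid_add_eq_0_iff: "u + v = 0 \<longleftrightarrow> u = 0 \<and> v = 0"
  for u v :: "'g free_monoid"
  by (cases u; cases v) (simp add: zero_free_monoid_def plus_free_monoid_def)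

type_synonym 'g free_algebra = "'g free_monoid \<Rightarrow>\<^sub>0 complex"

definition free_gen :: "'g \<Rightarrow> 'g free_algebra" where
  "free_gen g = Poly_Mapping.single (Word [g]) 1"

definition free_const :: "complex \<Rightarrow> 'g free_algebra" where
  "free_const c = Poly_Mapping.single 0 c"

inductive_set two_sided_ideal :: "'a::ring_1 set \<Rightarrow> 'a set" for S where
  zero: "0 \<in> two_sided_ideal S"
| gen: "s \<in> S \<Longrightarrow> a * s * b \<in> two_sided_ideal S"
| add: "x \<in> two_sided_ideal S \<Longrightarrow> y \<in> two_sided_ideal S \<Longrightarrow> x + y \<in> two_sided_ideal S"

lemma two_sided_ideal_mult_left: "x \<in> two_sided_ideal S \<Longrightarrow> a * x \<in> two_sided_ideal S"
proof (induction rule: two_sided_ideal.induct)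
  case (gen s b c)
  then show ?case
    using two_sided_ideal.gen[of s S "a * b" c] by (simp add: mult.assoc)
qed (auto simp: distrib_left intro: two_sided_ideal.intros)

lemma two_sided_ideal_mult_right: "x \<in> two_sided_ideal S \<Longrightarrow> x * a \<in> two_sided_ideal S"
proof (induction rule: two_sided_ideal.induct)
  case (gen s b c)
  then show ?case
    using two_sided_ideal.gen[of s S b "c * a"] by (simp add: mult.assoc)
qed (auto simp: distrib_right intro: two_sided_ideal.intros)

lemma two_sided_ideal_uminus: "x \<in> two_sided_ideal S \<Longrightarrow> - x \<in> two_sided_ideal S"
  using two_sided_ideal_mult_left[of x S "-1"] by simp

lemma two_sided_ideal_diff:
  "x \<in> two_sided_ideal S \<Longrightarrow> y \<in> two_sided_ideal S \<Longrightarrow> x - y \<in> two_sided_ideal S"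
  using two_sided_ideal.add[of x S "- y"] two_sided_ideal_uminus by auto

lemma two_sided_ideal_base: "s \<in> S \<Longrightarrow> s \<in> two_sided_ideal S"
  using two_sided_ideal.gen[of s S 1 1] by simp


section \<open>The Racah algebra\<close>

datatype racah_gen = GR1 | GR2 | GR3 | Gd | Ge1 | Ge2 | GGamma

definition racah_relators :: "racah_gen free_algebra set" where
  "racah_relators =
    (let r1 = free_gen GR1; r2 = free_gen GR2; r3 = free_gen GR3;
         d = free_gen Gd; e1 = free_gen Ge1; e2 = free_gen Ge2; \<gamma> = free_gen GGamma
     in {commutator c (free_gen g) | c g. c \<in> {d, e1, e2, \<gamma>}} \<union>
        {commutator r1 r2 - r3,
         commutator r3 r1 - (r1^2 + anticommutator r1 r2 + d * r1 + e2),
         commutator r2 r3 - (r2^2 + anticommutator r1 r2 + d * r2 + e1),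
         \<gamma> - (anticommutator (r1^2) r2 + anticommutator r1 (r2^2) + r1^2 + r2^2 + r3^2
              + (d + 1) * anticommutator r1 r2 + (2 * e1 + d) * r1 + (2 * e2 + d) * r2)})"

definition racah_eq :: "racah_gen free_algebra \<Rightarrow> racah_gen free_algebra \<Rightarrow> bool" where
  "racah_eq x y \<longleftrightarrow> x - y \<in> two_sided_ideal racah_relators"

lemma equivp_racah_eq: "equivp racah_eq"
proof (rule equivpI)
  show "reflp racah_eq"
    by (simp add: reflp_def racah_eq_def two_sided_ideal.zero)
  show "symp racah_eq"
    unfolding symp_def racah_eq_def using two_sided_ideal_uminus by fastforce
  show "transp racah_eq"
    unfolding transp_def racah_eq_def using two_sided_ideal.add by fastforce
qed

quotient_type racah = "racah_gen free_algebra" / racah_eq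
  by (rule equivp_racah_eq)

text \<open>
  Nontriviality, needed for the class \<^class>\<open>ring_1\<close>: the augmentation (constant coefficient)
  vanishes on all relators.
\<close>

lemma lookup_mult_zero:
  fixes f g :: "'g free_algebra"
  shows "Poly_Mapping.lookup (f * g) 0 = Poly_Mapping.lookup f 0 * Poly_Mapping.lookup g 0"
proof -
  let ?f = "Poly_Mapping.lookup f" and ?g = "Poly_Mapping.lookup g"
  have inner: "Sum_any (\<lambda>q. ?g q when 0 = l + q) = (?g 0 when l = 0)" for l
  proof -
    have "Sum_any (\<lambda>q. ?g q when 0 = l + q) = Sum_any (\<lambda>q. (?g q when l = 0) when q = 0)"
    proof (rule Sum_any.cong)
      fix q
      have "0 = l + q \<longleftrightarrow> l = 0 \<and> q = 0"
        by (metis free_monoid_add_eq_0_iff)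
      then show "(?g q when 0 = l + q) = ((?g q when l = 0) when q = 0)"
        by (auto simp: when_def)
    qed
    then show ?thesis by simp
  qed
  show ?thesis
    unfolding lookup_mult inner mult_when by simp
qed

lemma lookup_free_gen_zero: "Poly_Mapping.lookup (free_gen g) 0 = 0"
  by (simp add: free_gen_def lookup_single zero_free_monoid_def)

lemma lookup_racah_relators_zero: "s \<in> racah_relators \<Longrightarrow> Poly_Mapping.lookup s 0 = 0"
  by (auto simp: racah_relators_def Let_def commutator_def anticommutator_def lookup_minus
      lookup_add lookup_mult_zero lookup_free_gen_zero power2_eq_square)

lemma lookup_racah_ideal_zero: "x \<in> two_sided_ideal racah_relators \<Longrightarrow> Poly_Mapping.lookup x 0 = 0"
  by (induction rule: two_sided_ideal.induct)
    (simp_all add: lookup_add lookup_mult_zero lookup_racah_relators_zero)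

instantiation racah :: ring_1
begin

lift_definition zero_racah :: racah is 0 .

lift_definition one_racah :: racah is 1 .

lift_definition plus_racah :: "racah \<Rightarrow> racah \<Rightarrow> racah" is "(+)"
  unfolding racah_eq_def using two_sided_ideal.add by (fastforce simp: algebra_simps)

lift_definition minus_racah :: "racah \<Rightarrow> racah \<Rightarrow> racah" is "(-)"
  unfolding racah_eq_def using two_sided_ideal_diff by (fastforce simp: algebra_simps)

lift_definition uminus_racah :: "racah \<Rightarrow> racah" is uminus
  unfolding racah_eq_def using two_sided_ideal_uminus by (fastforce simp: algebra_simps)

lift_definition times_racah :: "racah \<Rightarrow> racah \<Rightarrow> racah" is "(*)"
proof -
  fix a b c d :: "racah_gen free_algebra"
  assume "racah_eq a b" "racah_eq c d"
  then have "(a - b) * c + b * (c - d) \<in> two_sided_ideal racah_relators"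
    unfolding racah_eq_def
    by (intro two_sided_ideal.add two_sided_ideal_mult_left two_sided_ideal_mult_right)
  then show "racah_eq (a * c) (b * d)"
    by (simp add: racah_eq_def algebra_simps)
qed

instance
proof
  have "Poly_Mapping.lookup (0 - 1 :: racah_gen free_algebra) 0 \<noteq> 0"
    by (simp add: lookup_minus)
  then show "(0 :: racah) \<noteq> 1"
    using lookup_racah_ideal_zero by (transfer, unfold racah_eq_def) blast
qed (transfer, simp add: racah_eq_def two_sided_ideal.zero algebra_simps)+

end

lift_definition racah_const :: "complex \<Rightarrow> racah" is free_const .

definition scaleC :: "complex \<Rightarrow> racah \<Rightarrow> racah" (infixr \<open>*\<^sub>C\<close> 75) where
  "c *\<^sub>C x = racah_const c * x"

lift_definition R1 :: racah is "free_gen GR1" .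
lift_definition R2 :: racah is "free_gen GR2" .
lift_definition R3 :: racah is "free_gen GR3" .
lift_definition Rd :: racah is "free_gen Gd" .
lift_definition Re1 :: racah is "free_gen Ge1" .
lift_definition Re2 :: racah is "free_gen Ge2" .
lift_definition R\<Gamma> :: racah is "free_gen GGamma" .


section \<open>Polynomials in the parameters and the central elements\<close>

datatype param = Vz0 | Vz1 | Vz2 | Vz3 | Vz4 | Vd | Ve1 | Ve2 | VGamma

type_synonym param_poly = "(param \<Rightarrow>\<^sub>0 nat) \<Rightarrow>\<^sub>0 complex"

text \<open>
  Evaluation at \<open>z\<^sub>0, \<dots>, z\<^sub>4\<close> and at the central elements. The latter commute in
  \<^typ>\<open>racah\<close>, so the order of the factors does not matter.
\<close>

definition eval_param_poly ::
  "param_poly \<Rightarrow> complex \<Rightarrow> complex \<Rightarrow> complex \<Rightarrow> complex \<Rightarrow> complex \<Rightarrow> racah" where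
  "eval_param_poly p z0 z1 z2 z3 z4 =
    (\<Sum>m \<in> Poly_Mapping.keys p. let n = Poly_Mapping.lookup m in
      (Poly_Mapping.lookup p m * z0 ^ n Vz0 * z1 ^ n Vz1 * z2 ^ n Vz2 * z3 ^ n Vz3 * z4 ^ n Vz4)
      *\<^sub>C (Rd ^ n Vd * Re1 ^ n Ve1 * Re2 ^ n Ve2 * R\<Gamma> ^ n VGamma))"


section \<open>The elements A and B\<close>

definition elemA :: "complex \<Rightarrow> complex \<Rightarrow> complex \<Rightarrow> racah" where
  "elemA z0 z1 z2 = racah_const z0 + z1 *\<^sub>C R1 + z2 *\<^sub>C R2 + 2 * R3"

definition elemB :: "complex \<Rightarrow> complex \<Rightarrow> complex \<Rightarrow> complex \<Rightarrow> racah" where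
  "elemB z1 z2 z3 z4 =
    racah_const z3 + (z1 * (z1 + z4) / 2) *\<^sub>C R1 + (z2 * (z2 + z4) / 2) *\<^sub>C R2
    + z4 *\<^sub>C R3 + 2 * anticommutator R1 R2"

end

theory Submission
  imports Defs
begin

text \<open>
  Up to an affine change of variables \<open>A = z\<^sub>0 + 2 P\<close> and \<open>B = z\<^sub>3 + 2 Q + z\<^sub>4 P\<close>, where
  \<open>P = u R\<^sub>1 + v R\<^sub>2 + R\<^sub>3\<close> and \<open>Q = u\<^sup>2 R\<^sub>1 + v\<^sup>2 R\<^sub>2 + {R\<^sub>1, R\<^sub>2}\<close> with \<open>z\<^sub>1 = 2 u\<close>, \<open>z\<^sub>2 = 2 v\<close>.
  Such a change of variables preserves the shape of the two relations, so it suffices to know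
  them for \<open>P\<close> and \<open>Q\<close>. There they are checked on normal forms: the defining relations rewrite
  every element to a combination of the ordered monomials \<open>R\<^sub>1\<^sup>i R\<^sub>2\<^sup>j R\<^sub>3\<^sup>k\<close> with \<open>k \<le> 1\<close> (the
  relation for \<open>\<Gamma>\<close> eliminates \<open>R\<^sub>3\<^sup>2\<close>). The coefficients are kept in a commutative ring
  mapping to the centre, here the ring of parameter polynomials under evaluation, so that
  comparing normal forms amounts to identities between commutative polynomials.
\<close>

section \<open>Centre and generators of the Racah algebra\<close>

lemma poly_mapping_induct [case_names zero single add]:
  fixes p :: "'a \<Rightarrow>\<^sub>0 'b::ab_group_add"
  assumes "P 0" "\<And>k c. P (Poly_Mapping.single k c)" "\<And>p q. P p \<Longrightarrow> P q \<Longrightarrow> P (p + q)"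
  shows "P p"
proof (induction p rule: update_induct)
  case const
  then show ?case by (rule assms(1))
next
  case (update f k c)
  have "Poly_Mapping.update k c f = f + Poly_Mapping.single k c"
    using update.hyps(1)
    by (intro poly_mapping_eqI)
      (auto simp: lookup_update lookup_add lookup_single when_def in_keys_iff)
  then show ?case
    using update assms by simp
qed

text \<open>A word is the product of its letters, and a monomial is a constant times a word.\<close>

lemma free_algebra_induct [case_names const gen add mult]:
  fixes p :: "'g free_algebra"
  assumes const: "\<And>c. P (free_const c)" and gen: "\<And>g. P (free_gen g)"
    and add: "\<And>p q. P p \<Longrightarrow> P q \<Longrightarrow> P (p + q)" and mult: "\<And>p q. P p \<Longrightarrow> P q \<Longrightarrow> P (p * q)"
  shows "P p"
proof (induction p rule: poly_mapping_induct)
  case zero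
  then show ?case using const[of 0] by (simp add: free_const_def)
next
  case (single m c)
  have word: "P (Poly_Mapping.single (Word gs) 1)" for gs
  proof (induction gs)
    case Nil
    then show ?case using const[of 1] by (simp add: free_const_def zero_free_monoid_def)
  next
    case (Cons g gs)
    have "Poly_Mapping.single (Word (g # gs)) (1::complex)
        = free_gen g * Poly_Mapping.single (Word gs) 1"
      by (simp add: free_gen_def mult_single plus_free_monoid_def)
    then show ?case using mult[OF gen Cons] by simp
  qed
  have "Poly_Mapping.single m c = free_const c * Poly_Mapping.single (Word (letters m)) 1"
    by (simp add: free_const_def mult_single)
  then show ?case using mult[OF const word] by metis
qed (rule add)

lift_definition racah_generator :: "racah_gen \<Rightarrow> racah" is free_gen .

lemma racah_generator_simps:
  "racah_generator GR1 = R1" "racah_generator GR2 = R2" "racah_generator GR3 = R3"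
  "racah_generator Gd = Rd" "racah_generator Ge1 = Re1" "racah_generator Ge2 = Re2"
  "racah_generator GGamma = R\<Gamma>"
  by (transfer, simp add: racah_eq_def two_sided_ideal.zero)+

lemma racah_induct [case_names const gen add mult]:
  assumes "\<And>c. P (racah_const c)" "\<And>g. P (racah_generator g)"
    and "\<And>x y. P x \<Longrightarrow> P y \<Longrightarrow> P (x + y)" "\<And>x y. P x \<Longrightarrow> P y \<Longrightarrow> P (x * y)"
  shows "P x"
proof (induct x rule: racah.abs_induct)
  fix p
  show "P (abs_racah p)"
    by (induction p rule: free_algebra_induct)
      (use assms in \<open>simp_all flip: racah_const.abs_eq racah_generator.abs_eq
        plus_racah.abs_eq times_racah.abs_eq\<close>)
qed

lemma racah_eqI: "x - y \<in> racah_relators \<Longrightarrow> racah_eq x y"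
  by (simp add: racah_eq_def two_sided_ideal_base)

lemma racah_const_0 [simp]: "racah_const 0 = 0"
  by transfer (simp add: free_const_def racah_eq_def two_sided_ideal.zero)

lemma racah_const_1 [simp]: "racah_const 1 = 1"
  by transfer (simp add: free_const_def racah_eq_def two_sided_ideal.zero)

lemma racah_const_add: "racah_const (a + b) = racah_const a + racah_const b"
  by transfer (simp add: free_const_def racah_eq_def two_sided_ideal.zero single_add)

lemma racah_const_mult: "racah_const (a * b) = racah_const a * racah_const b"
  by transfer (simp add: free_const_def racah_eq_def two_sided_ideal.zero mult_single)

section \<open>Central elements\<close>

definition central :: "'a::ring_1 \<Rightarrow> bool" where
  "central c \<longleftrightarrow> (\<forall>x. x * c = c * x)"

lemma central_commute: "central c \<Longrightarrow> x * c = c * x"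
  by (simp add: central_def)

lemma central_1 [simp]: "central 1"
  by (simp add: central_def)

lemma central_0 [simp]: "central 0"
  by (simp add: central_def)

lemma central_add: "central a \<Longrightarrow> central b \<Longrightarrow> central (a + b)"
  by (simp add: central_def algebra_simps)

lemma central_mult: "central a \<Longrightarrow> central b \<Longrightarrow> central (a * b)"
  unfolding central_def by (metis mult.assoc)

lemma central_power: "central a \<Longrightarrow> central (a ^ n)"
  by (induction n) (simp_all add: central_mult)

lemma central_mult_mult: "central b \<Longrightarrow> (a * b) * (a' * b') = (a * a') * (b * b')"
  unfolding central_def by (metis mult.assoc)

text \<open>The elements commuting with \<open>c\<close> are closed under sums and products.\<close>

lemma central_racahI:
  assumes "\<And>a. c * racah_const a = racah_const a * c"
    and "\<And>g. c * racah_generator g = racah_generator g * c"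
  shows "central c"
proof -
  have "x * c = c * x" for x
  proof (induction x rule: racah_induct)
    case (mult x y)
    then show ?case by (metis mult.assoc)
  qed (simp_all add: assms distrib_left distrib_right)
  then show ?thesis by (simp add: central_def)
qed

lemma central_racah_const: "central (racah_const a)"
proof (rule central_racahI)
  show "racah_const a * racah_const b = racah_const b * racah_const a" for b
    by (metis racah_const_mult mult.commute)
  show "racah_const a * racah_generator g = racah_generator g * racah_const a" for g
    by transfer (simp add: free_const_def free_gen_def mult_single racah_eq_def two_sided_ideal.zero)
qed

lemma central_racah_generator:
  assumes "h \<in> {Gd, Ge1, Ge2, GGamma}"
  shows "central (racah_generator h)"
proof (rule central_racahI)
  show "racah_generator h * racah_const a = racah_const a * racah_generator h" for a
    by (rule central_commute[OF central_racah_const])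
  show "racah_generator h * racah_generator g = racah_generator g * racah_generator h" for g
    using assms
  proof (transfer fixing: h)
    fix g assume h: "h \<in> {Gd, Ge1, Ge2, GGamma}"
    show "racah_eq (free_gen h * free_gen g) (free_gen g * free_gen h)"
      \<comment> \<open>The commutator of \<open>h\<close> with any generator is itself a
        relator.\<close>
      by (rule racah_eqI) (use h in \<open>force simp: racah_relators_def commutator_def Let_def\<close>)
  qed
qed

lemma central_racah: "central Rd" "central Re1" "central Re2" "central R\<Gamma>"
  using central_racah_generator racah_generator_simps by (metis insertCI)+

lemma racah_relations:
  "commutator R1 R2 = R3"
  "commutator R3 R1 = R1^2 + anticommutator R1 R2 + Rd * R1 + Re2"
  "commutator R2 R3 = R2^2 + anticommutator R1 R2 + Rd * R2 + Re1"
  "R\<Gamma> = anticommutator (R1^2) R2 + anticommutator R1 (R2^2) + R1^2 + R2^2 + R3^2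
    + (Rd + 1) * anticommutator R1 R2 + (2 * Re1 + Rd) * R1 + (2 * Re2 + Rd) * R2"
  \<comment> \<open>\<open>2\<close> and the squares become sums and products of lifted operations,
    which transfer can follow.\<close>
  unfolding commutator_def anticommutator_def power2_eq_square one_add_one[symmetric]
  by (transfer, rule racah_eqI,
      simp add: racah_relators_def commutator_def anticommutator_def power2_eq_square Let_def)+

section \<open>Evaluation of parameter polynomials\<close>

text \<open>Terms may cancel, so \<open>p + q\<close> can have a smaller support than
  \<open>p\<close> and \<open>q\<close> together. As \<open>F m 0 = 0\<close>, all three sums may be
  taken over the union of the supports.\<close>

lemma sum_keys_add:
  fixes p q :: "'a \<Rightarrow>\<^sub>0 'b::monoid_add" and F :: "'a \<Rightarrow> 'b \<Rightarrow> 'c::comm_monoid_add"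
  assumes "\<And>m. F m 0 = 0" "\<And>m a b. F m (a + b) = F m a + F m b"
  shows "(\<Sum>m\<in>Poly_Mapping.keys (p + q). F m (Poly_Mapping.lookup (p + q) m))
    = (\<Sum>m\<in>Poly_Mapping.keys p. F m (Poly_Mapping.lookup p m))
      + (\<Sum>m\<in>Poly_Mapping.keys q. F m (Poly_Mapping.lookup q m))"
proof -
  have *: "(\<Sum>m\<in>Poly_Mapping.keys r. F m (Poly_Mapping.lookup r m))
      = (\<Sum>m\<in>Poly_Mapping.keys p \<union> Poly_Mapping.keys q. F m (Poly_Mapping.lookup r m))"
    if "Poly_Mapping.keys r \<subseteq> Poly_Mapping.keys p \<union> Poly_Mapping.keys q" for r
    using that by (intro sum.mono_neutral_left) (auto simp: in_keys_iff assms(1))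
  show ?thesis
    unfolding *[OF keys_add] *[OF Un_upper1] *[OF Un_upper2]
    by (simp add: lookup_add assms(2) sum.distrib)
qed

context
  fixes z0 z1 z2 z3 z4 :: complex
begin

abbreviation (input) "\<phi> p \<equiv> eval_param_poly p z0 z1 z2 z3 z4"

text \<open>The value of a monomial is split into a complex number and a product of central
  generators, each of which turns sums of exponents into products.\<close>

definition scalar_value :: "(param \<Rightarrow>\<^sub>0 nat) \<Rightarrow> complex" where
  "scalar_value m = (let n = Poly_Mapping.lookup m in
     z0 ^ n Vz0 * z1 ^ n Vz1 * z2 ^ n Vz2 * z3 ^ n Vz3 * z4 ^ n Vz4)"

definition central_value :: "(param \<Rightarrow>\<^sub>0 nat) \<Rightarrow> racah" where
  "central_value m = (let n = Poly_Mapping.lookup m in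
     Rd ^ n Vd * Re1 ^ n Ve1 * Re2 ^ n Ve2 * R\<Gamma> ^ n VGamma)"

lemma eval_param_poly_altdef:
  "\<phi> p = (\<Sum>m\<in>Poly_Mapping.keys p.
     racah_const (Poly_Mapping.lookup p m * scalar_value m) * central_value m)"
  by (simp add: eval_param_poly_def scaleC_def scalar_value_def central_value_def Let_def mult.assoc)

lemma scalar_value_add: "scalar_value (m + n) = scalar_value m * scalar_value n"
  by (simp add: scalar_value_def Let_def lookup_add power_add)

lemma central_value_add: "central_value (m + n) = central_value m * central_value n"
  by (simp only: central_value_def Let_def lookup_add power_add
      central_racah(2-4)[THEN central_power, THEN central_mult_mult])

lemma central_central_value: "central (central_value m)"
  by (simp add: central_value_def Let_def central_mult central_power central_racah)

lemma eval_param_poly_single: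
  "\<phi> (Poly_Mapping.single m c) = racah_const (c * scalar_value m) * central_value m"
  by (simp add: eval_param_poly_altdef)

lemma eval_param_poly_0: "\<phi> 0 = 0"
  by (simp add: eval_param_poly_altdef)

lemma eval_param_poly_add: "\<phi> (p + q) = \<phi> p + \<phi> q"
  unfolding eval_param_poly_altdef
  by (rule sum_keys_add) (simp_all add: racah_const_add distrib_right)

text \<open>Both sides are additive in \<open>p\<close> and in \<open>q\<close>, which leaves single
  monomials; there the central factors move past the constants.\<close>

lemma eval_param_poly_mult: "\<phi> (p * q) = \<phi> p * \<phi> q"
proof (induction p rule: poly_mapping_induct)
  case (single m a)
  show ?case
  proof (induction q rule: poly_mapping_induct)
    case (single n b)
    have "racah_const ((a * b) * (scalar_value m * scalar_value n))
        = racah_const (a * scalar_value m) * racah_const (b * scalar_value n)"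
      by (simp add: racah_const_mult[symmetric] ac_simps)
    moreover have "racah_const s * central_value m * (racah_const t * central_value n)
        = racah_const s * racah_const t * (central_value m * central_value n)" for s t
      by (rule central_mult_mult[OF central_central_value])
    ultimately show ?case
      by (simp add: mult_single eval_param_poly_single scalar_value_add central_value_add)
  qed (simp_all add: eval_param_poly_0 eval_param_poly_add distrib_left)
qed (simp_all add: eval_param_poly_0 eval_param_poly_add distrib_right)

lemma eval_param_poly_1: "\<phi> 1 = 1"
  using eval_param_poly_single[of 0 1] by (simp add: scalar_value_def central_value_def)

lemma central_eval_param_poly: "central (\<phi> p)"
  by (induction p rule: poly_mapping_induct)
    (simp_all add: eval_param_poly_0 eval_param_poly_add eval_param_poly_single central_add
      central_mult central_racah_const central_central_value)

definition var :: "param \<Rightarrow> param_poly" where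
  "var i = Poly_Mapping.single (Poly_Mapping.single i 1) 1"

lemma eval_var:
  "\<phi> (var Vz0) = racah_const z0" "\<phi> (var Vz1) = racah_const z1" "\<phi> (var Vz2) = racah_const z2"
  "\<phi> (var Vz3) = racah_const z3" "\<phi> (var Vz4) = racah_const z4"
  "\<phi> (var Vd) = Rd" "\<phi> (var Ve1) = Re1" "\<phi> (var Ve2) = Re2" "\<phi> (var VGamma) = R\<Gamma>"
  by (simp_all add: var_def eval_param_poly_single scalar_value_def central_value_def lookup_single)

end

section \<open>The relations over a commutative coefficient ring\<close>

text \<open>
  In \<open>racah_scalars\<close> the parameters of the statement are \<open>z\<^sub>0 = r\<close>, \<open>z\<^sub>1 = 2 u\<close>, \<open>z\<^sub>2 = 2 v\<close>,
  \<open>z\<^sub>3 = t\<close>, \<open>z\<^sub>4 = 2 s\<close>, which makes all coefficients integral. The \<open>\<alpha>\<^sub>i\<close> are the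
  coefficients for the pair \<open>P, Q\<close> below, the \<open>b\<^sub>i\<close> those for \<open>2 P, 2 Q + 2 s P\<close>, and the \<open>c\<^sub>i\<close>
  those for \<open>A, B\<close>.
\<close>

locale racah_scalars =
  fixes d e1 e2 g u v r s t :: "'k::comm_ring_1"
begin

definition "\<alpha>1 = 2 * (u + v)"

definition "\<alpha>2 = d - 1 - u^2 - 3 * u * v - v^2"

definition "\<alpha>3 = - 3 * u^2 * v - 3 * u * v^2 - 2 * u - 2 * v"

definition "\<alpha>4 = 2 * u * v * d + d^2 - d - 4 * e1 - 4 * e2"

definition "\<alpha>5 = 4 * u * e2 + 4 * v * e1 - u^2 * v * d - u * v^2 * d"

definition "\<alpha>6 = 2 * u^2 * e2 + 2 * v^2 * e1 - 2 * u^2 * v^2 * d - 2 * u * v * d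
  + 2 * e1 + 2 * e2 + 2 * g"

definition "\<alpha>8 = u^3 * v * e2 + u * v^3 * e1 - u^2 * v^2 * e1 - u^2 * v^2 * e2
  + u^2 * d * e2 + v^2 * d * e1 + u^2 * e1 + v^2 * e2 + u^2 * g + v^2 * g
  - u * v * e1 - u * v * e2 - u * v * g - d * e1 - d * e2 - d * g - 4 * e1 * e2"

definition "\<alpha>9 = u^4 * v * e2 + u * v^4 * e1 - u^3 * v^2 * e2 - u^2 * v^3 * e1
  + u^2 * v * e1 - u^2 * v * e2 - u * v^2 * e1 + u * v^2 * e2 + u^2 * v * g + u * v^2 * g"

definition "b1 = 2 * \<alpha>1 + 6 * s"

definition "b2 = 2 * \<alpha>2 - 6 * s^2 - 4 * s * \<alpha>1"

definition "b3 = 2 * \<alpha>3 + 4 * s * \<alpha>2 - 2 * s^2 * \<alpha>1 + s * b2"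

definition "b5 = 4 * \<alpha>5 - 4 * s * \<alpha>4"

definition "b6 = 4 * \<alpha>6 + 4 * s * \<alpha>5 + s * b5"

definition "b9 = 8 * \<alpha>9 + 8 * s * \<alpha>8"

text \<open>Translation by \<open>r\<close> and \<open>t\<close> keeps \<open>b1\<close> and
  \<open>b2\<close>, while the cubic term adds \<open>6 * r\<close> to \<open>b3\<close>. The
  coefficients \<open>4 * \<alpha>4\<close> and \<open>8 * \<alpha>8\<close> of the scaled pair
  enter \<open>c4\<close> and \<open>c8\<close> directly.\<close>

definition "c3 = b3 + 6 * r"

definition "c4 = 4 * \<alpha>4 + 12 * t - 2 * r * b1"

definition "c5 = b5 - 2 * t * b1 - 2 * r * b2"

definition "c6 = b6 - 6 * r^2 + 2 * t * b2 - 2 * r * b3"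

definition "c8 = 8 * \<alpha>8 - 6 * t^2 + 2 * r * t * b1 + r^2 * b2 - 4 * t * \<alpha>4 - r * b5"

definition "c9 = b9 + 2 * r^3 - t^2 * b1 - 2 * r * t * b2 + r^2 * b3 + t * b5 - r * b6"

lemmas \<alpha>_defs = \<alpha>1_def \<alpha>2_def \<alpha>3_def \<alpha>4_def \<alpha>5_def \<alpha>6_def \<alpha>8_def \<alpha>9_def

lemmas bc_defs = b1_def b2_def b3_def b5_def b6_def b9_def c3_def c4_def c5_def c6_def c8_def c9_def

end

locale racah_triple = racah_scalars d e1 e2 g u v r s t
  for d e1 e2 g u v r s t :: "'k::comm_ring_1" +
  fixes \<phi> :: "'k \<Rightarrow> 'a::ring_1" and x y w :: 'a
  assumes \<phi>_1: "\<phi> 1 = 1"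
    and \<phi>_add: "\<phi> (k + l) = \<phi> k + \<phi> l"
    and \<phi>_mult: "\<phi> (k * l) = \<phi> k * \<phi> l"
    and central_\<phi>: "central (\<phi> k)"
    and commutator_xy: "commutator x y = w"
    and commutator_wx: "commutator w x = x^2 + anticommutator x y + \<phi> d * x + \<phi> e2"
    and commutator_yw: "commutator y w = y^2 + anticommutator x y + \<phi> d * y + \<phi> e1"
    and casimir: "\<phi> g = anticommutator (x^2) y + anticommutator x (y^2) + x^2 + y^2 + w^2
      + (\<phi> d + 1) * anticommutator x y + (2 * \<phi> e1 + \<phi> d) * x + (2 * \<phi> e2 + \<phi> d) * y"
begin

section \<open>Linear combinations over the coefficient ring\<close>

definition smul :: "'k \<Rightarrow> 'a \<Rightarrow> 'a" (infixr "\<cdot>" 75) where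
  "k \<cdot> a = \<phi> k * a"

lemma \<phi>_0: "\<phi> 0 = 0"
  using \<phi>_add[of 0 0] by simp

lemma \<phi>_minus: "\<phi> (- k) = - \<phi> k"
  using \<phi>_add[of "- k" k] by (simp add: \<phi>_0 eq_neg_iff_add_eq_0)

lemma \<phi>_numeral: "\<phi> (numeral n) = numeral n"
  by (induction n) (simp_all only: numeral.simps \<phi>_1 \<phi>_add)

lemma smul_1: "1 \<cdot> a = a"
  by (simp add: smul_def \<phi>_1)

text \<open>Removes subtraction, so that expanding yields pure sums of scaled words.\<close>

lemma diff_smul: "a - b = a + (-1) \<cdot> b"
  by (simp add: smul_def \<phi>_minus \<phi>_1)

lemma smul_smul: "k \<cdot> l \<cdot> a = (k * l) \<cdot> a"
  by (simp add: smul_def \<phi>_mult mult.assoc)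

lemma smul_add: "k \<cdot> (a + b) = k \<cdot> a + k \<cdot> b"
  by (simp add: smul_def distrib_left)

lemma smul_diff: "k \<cdot> (a - b) = k \<cdot> a - k \<cdot> b"
  by (simp add: smul_def right_diff_distrib)

lemma add_smul: "(k + l) \<cdot> a = k \<cdot> a + l \<cdot> a"
  by (simp add: smul_def \<phi>_add distrib_right)

lemma smul_mult: "(k \<cdot> a) * b = k \<cdot> (a * b)"
  by (simp add: smul_def mult.assoc)

lemma mult_smul: "a * (k \<cdot> b) = k \<cdot> (a * b)"
  unfolding smul_def by (metis central_commute central_\<phi> mult.assoc)

lemma double: "2 * a = a + a" "a * 2 = a + a" for a :: 'a
  by (simp_all add: mult_2 mult_2_right)

section \<open>Reordering of words\<close>

text \<open>
  Every word carries a scalar, even \<open>1\<close>, so that after multiplying out each side of an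
  equation is a sum of terms \<open>k \<cdot> m\<close>, as \<open>collect\<close> below requires.
\<close>

lemma yx: "y * x = 1 \<cdot> (x * y) + (-1) \<cdot> w"
  using commutator_xy by (auto simp: commutator_def smul_1 simp flip: diff_smul)

lemma wx: "w * x = 1 \<cdot> (x * w) + 1 \<cdot> (x * x) + 1 \<cdot> (x * y) + 1 \<cdot> (y * x) + d \<cdot> x + e2 \<cdot> 1"
  using commutator_wx
  by (simp add: commutator_def anticommutator_def power2_eq_square smul_1 smul_def \<phi>_1 algebra_simps)

lemma wy: "w * y = 1 \<cdot> (y * w) - 1 \<cdot> (y * y) - 1 \<cdot> (x * y) - 1 \<cdot> (y * x) - d \<cdot> y - e1 \<cdot> 1"
  using commutator_yw
  by (simp add: commutator_def anticommutator_def power2_eq_square smul_1 smul_def \<phi>_1 algebra_simps)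

lemma ww: "w * w = g \<cdot> 1 - 1 \<cdot> (x * x * y) - 1 \<cdot> (y * x * x) - 1 \<cdot> (x * y * y) - 1 \<cdot> (y * y * x)
    - 1 \<cdot> (x * x) - 1 \<cdot> (y * y) - (d + 1) \<cdot> (x * y) - (d + 1) \<cdot> (y * x)
    - (2 * e1 + d) \<cdot> x - (2 * e2 + d) \<cdot> y"
  using casimir
  by (simp add: anticommutator_def power2_eq_square smul_def \<phi>_1 \<phi>_add \<phi>_mult \<phi>_numeral
      double algebra_simps)

text \<open>Restricted to \<^typ>\<open>'a\<close>, so that rewriting does not multiply out the scalars as well.\<close>

lemma ring_laws:
  fixes a b c :: 'a
  shows "a * (b + c) = a * b + a * c" "(a + b) * c = a * c + b * c"
    "a * b * c = a * (b * c)" "a * 1 = a" "1 * a = a" "a + (b + c) = a + b + c"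
  by (simp_all add: algebra_simps)

lemma mult_eq_left: "a * b = c \<Longrightarrow> a * (b * z) = c * z" for a b c z :: 'a
  by (metis mult.assoc)

lemmas expand = ring_laws diff_smul smul_smul smul_add smul_mult mult_smul

text \<open>Products associate to the right, so each rule also appears with a further factor behind
  it. With weight 2 for \<open>x\<close> and \<open>y\<close> and weight 3 for \<open>w\<close>,
  every rule produces words of smaller weight, or of equal weight with fewer \<open>w\<close>, or
  with one inversion fewer; hence the rewriting terminates.\<close>

lemmas reorder = yx wx wy ww yx[THEN mult_eq_left] wx[THEN mult_eq_left]
  wy[THEN mult_eq_left] ww[THEN mult_eq_left]

section \<open>Collecting coefficients by position\<close>

definition combination :: "'a list \<Rightarrow> 'k list \<Rightarrow> 'a" where
  "combination ms cs = sum_list (map2 (\<cdot>) cs ms)"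

lemma combination_list_update:
  "i < length cs \<Longrightarrow> length cs = length ms \<Longrightarrow>
    combination ms cs + k \<cdot> (ms ! i) = combination ms (cs[i := cs ! i + k])"
  unfolding combination_def
proof (induction cs ms arbitrary: i rule: list_induct2')
  case (4 c cs m ms)
  then show ?case
    by (cases i) (auto simp: add_smul algebra_simps)
qed auto

text \<open>Sums associate to the left, so the combination stands innermost and absorbs the terms
  \<open>k \<cdot> m\<close> one after another.\<close>

lemma collect:
  "ms ! i = m \<Longrightarrow> i < length cs \<Longrightarrow> length cs = length ms \<Longrightarrow>
    combination ms cs + k \<cdot> m = combination ms (cs[i := cs ! i + k])"
  using combination_list_update by blast

text \<open>Applied backwards with zero coefficients, it places an empty accumulator in front of
  both sides.\<close>

lemma combination_cancel:
  "combination ms cs + a = combination ms cs + b \<Longrightarrow> a = b"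
  by simp

text \<open>These are all ordered monomials, with at most one \<open>w\<close>, of weight at most 10
  (\<open>x\<close> and \<open>y\<close> weigh 2, \<open>w\<close> weighs 3). This is the weight of
  \<open>Q * C\<close>, and reordering never raises weights.\<close>

definition ordered_monomials :: "'a list" where
  "ordered_monomials = [
    1, x, y, w, x * x, x * y, y * y, x * w, y * w, x * (x * x), x * (x * y), x * (y * y),
    y * (y * y), x * (x * w), x * (y * w), y * (y * w), x * (x * (x * x)), x * (x * (x * y)),
    x * (x * (y * y)), x * (y * (y * y)), y * (y * (y * y)), x * (x * (x * w)),
    x * (x * (y * w)), x * (y * (y * w)), y * (y * (y * w)), x * (x * (x * (x * x))),
    x * (x * (x * (x * y))), x * (x * (x * (y * y))), x * (x * (y * (y * y))),
    x * (y * (y * (y * y))), y * (y * (y * (y * y)))]"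

lemma nth_ordered_monomials:
  "ordered_monomials ! 0 = 1" "ordered_monomials ! 1 = x" "ordered_monomials ! 2 = y"
  "ordered_monomials ! 3 = w" "ordered_monomials ! 4 = x * x" "ordered_monomials ! 5 = x * y"
  "ordered_monomials ! 6 = y * y" "ordered_monomials ! 7 = x * w"
  "ordered_monomials ! 8 = y * w" "ordered_monomials ! 9 = x * (x * x)"
  "ordered_monomials ! 10 = x * (x * y)" "ordered_monomials ! 11 = x * (y * y)"
  "ordered_monomials ! 12 = y * (y * y)" "ordered_monomials ! 13 = x * (x * w)"
  "ordered_monomials ! 14 = x * (y * w)" "ordered_monomials ! 15 = y * (y * w)"
  "ordered_monomials ! 16 = x * (x * (x * x))" "ordered_monomials ! 17 = x * (x * (x * y))"
  "ordered_monomials ! 18 = x * (x * (y * y))" "ordered_monomials ! 19 = x * (y * (y * y))"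
  "ordered_monomials ! 20 = y * (y * (y * y))" "ordered_monomials ! 21 = x * (x * (x * w))"
  "ordered_monomials ! 22 = x * (x * (y * w))" "ordered_monomials ! 23 = x * (y * (y * w))"
  "ordered_monomials ! 24 = y * (y * (y * w))"
  "ordered_monomials ! 25 = x * (x * (x * (x * x)))"
  "ordered_monomials ! 26 = x * (x * (x * (x * y)))"
  "ordered_monomials ! 27 = x * (x * (x * (y * y)))"
  "ordered_monomials ! 28 = x * (x * (y * (y * y)))"
  "ordered_monomials ! 29 = x * (y * (y * (y * y)))"
  "ordered_monomials ! 30 = y * (y * (y * (y * y)))"
  by (simp_all add: ordered_monomials_def)

lemma length_ordered_monomials: "length ordered_monomials = 31"
  by (simp add: ordered_monomials_def)

text \<open>One rule per monomial; the list is spelled out so that its update is already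
  evaluated.\<close>

lemmas ordered_collect = nth_ordered_monomials[THEN collect[where cs = "[
    k0, k1, k2, k3, k4, k5, k6, k7, k8, k9, k10, k11, k12, k13, k14, k15, k16, k17, k18, k19,
    k20, k21, k22, k23, k24, k25, k26, k27, k28, k29, k30]"
  for
    k0 k1 k2 k3 k4 k5 k6 k7 k8 k9 k10 k11 k12 k13 k14 k15 k16 k17 k18 k19 k20 k21 k22 k23 k24
    k25 k26 k27 k28 k29 k30],
  simplified length_ordered_monomials, simplified]

lemmas ordered_cancel = combination_cancel[where ms = ordered_monomials and cs = "[
    0, 0, 0, 0, 0, 0, 0, 0, 0, 0, 0, 0, 0, 0, 0, 0, 0, 0, 0, 0, 0, 0, 0, 0, 0, 0, 0, 0, 0, 0, 0]"]

section \<open>The relations for \<open>P\<close> and \<open>Q\<close>\<close>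

definition "P = u \<cdot> x + v \<cdot> y + 1 \<cdot> w"

definition "Q = u^2 \<cdot> x + v^2 \<cdot> y + 1 \<cdot> (x * y) + 1 \<cdot> (y * x)"

definition "C = P * Q - Q * P"

text \<open>With \<open>C\<close> in normal form, the double commutators below expand into far fewer
  words.\<close>

lemma C_eq: "C =
    (- 2) \<cdot> (x * x * y) + 2 \<cdot> (x * y * y) + (2 + 2 * u) \<cdot> (x * w)
    + (u + u^2) \<cdot> (x * x) + (4 + 2 * v + 2 * u - 2 * v^2 + 2 * u^2) \<cdot> (x * y)
    + (- 2 - 2 * v) \<cdot> (y * w) + (2 + v - v^2) \<cdot> (y * y)
    + (- 2 - v - u + v^2 - u^2 + u * v^2 - u^2 * v) \<cdot> w
    + (- 2 * e1 + u * d + u^2 * d) \<cdot> x + (2 * e2 + 2 * d + v * d - v^2 * d) \<cdot> y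
    + (2 * e1 + v * e1 + u * e2 - v^2 * e1 + u^2 * e2) \<cdot> 1"
  unfolding C_def P_def Q_def
  \<comment> \<open>Both sides become combinations of the same monomials; what remains is an
    identity of coefficient lists in \<open>'k\<close>.\<close>
  apply (rule ordered_cancel)
  apply (simp only: expand reorder)
  apply (simp only: ordered_collect)
  apply (rule arg_cong[where f = "combination ordered_monomials"])
  apply (simp add: algebra_simps power2_eq_square)
  done

lemma commutator_P_C:
  "P * C - C * P = (-3) \<cdot> (Q * Q) + \<alpha>1 \<cdot> (P * Q + Q * P) + \<alpha>2 \<cdot> (P * P)
    + \<alpha>4 \<cdot> Q + \<alpha>5 \<cdot> P + \<alpha>8 \<cdot> 1"
  unfolding C_eq P_def Q_def \<alpha>_defs
  apply (rule ordered_cancel)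
  apply (simp only: expand reorder)
  apply (simp only: ordered_collect)
  apply (rule arg_cong[where f = "combination ordered_monomials"])
  apply (simp add: algebra_simps eval_nat_numeral)
  done

text \<open>That \<open>\<alpha>1\<close>, \<open>\<alpha>2\<close>, \<open>\<alpha>5\<close> recur
  with opposite sign fits the Jacobi identity, by which
  \<open>[P, [Q, C]] = [Q, [P, C]]\<close>.\<close>

lemma commutator_Q_C:
  "Q * C - C * Q = (-2) \<cdot> (P * P * P) - \<alpha>1 \<cdot> (Q * Q) - \<alpha>2 \<cdot> (P * Q + Q * P)
    + \<alpha>3 \<cdot> (P * P) - \<alpha>5 \<cdot> Q + \<alpha>6 \<cdot> P + \<alpha>9 \<cdot> 1"
  unfolding C_eq P_def Q_def \<alpha>_defs
  apply (rule ordered_cancel)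
  apply (simp only: expand reorder)
  apply (simp only: ordered_collect)
  apply (rule arg_cong[where f = "combination ordered_monomials"])
  apply (simp add: algebra_simps eval_nat_numeral)
  done

section \<open>Passage from \<open>P\<close>, \<open>Q\<close> to \<open>A\<close>,
  \<open>B\<close>\<close>

definition "A = \<phi> r + \<phi> (2 * u) * x + \<phi> (2 * v) * y + 2 * w"

definition "B = \<phi> t + \<phi> (2 * u * (u + s)) * x + \<phi> (2 * v * (v + s)) * y + \<phi> (2 * s) * w
  + 2 * anticommutator x y"

lemma A_eq: "A = r \<cdot> 1 + 2 \<cdot> P"
  by (simp add: A_def P_def smul_def \<phi>_1 \<phi>_mult \<phi>_numeral double algebra_simps)

lemma B_eq: "B = t \<cdot> 1 + 2 \<cdot> Q + (2 * s) \<cdot> P"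
  by (simp add: B_def P_def Q_def anticommutator_def smul_def \<phi>_1 \<phi>_add \<phi>_mult \<phi>_numeral
      power2_eq_square algebra_simps double)

text \<open>From here on \<open>P\<close> and \<open>Q\<close> are formal noncommuting letters:
  \<open>P * Q\<close> and \<open>Q * P\<close> have separate positions, and the only cubic word
  comes from \<open>A^3\<close>.\<close>

definition "PQ_monomials = [1, P, Q, P * P, P * Q, Q * P, Q * Q, P * (P * P)]"

lemma nth_PQ_monomials:
  "PQ_monomials ! 0 = 1" "PQ_monomials ! 1 = P" "PQ_monomials ! 2 = Q" "PQ_monomials ! 3 = P * P"
  "PQ_monomials ! 4 = P * Q" "PQ_monomials ! 5 = Q * P" "PQ_monomials ! 6 = Q * Q"
  "PQ_monomials ! 7 = P * (P * P)"
  by (simp_all add: PQ_monomials_def)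

lemma length_PQ_monomials: "length PQ_monomials = 8"
  by (simp add: PQ_monomials_def)

lemmas PQ_collect = nth_PQ_monomials[THEN collect[where cs = "[k0, k1, k2, k3, k4, k5, k6, k7]"
  for k0 k1 k2 k3 k4 k5 k6 k7], simplified length_PQ_monomials, simplified]

lemmas PQ_cancel = combination_cancel[where ms = PQ_monomials and cs = "[0, 0, 0, 0, 0, 0, 0, 0]"]

lemma commutator_AB: "commutator A B = 4 \<cdot> C"
  unfolding A_eq B_eq C_def commutator_def
  apply (rule PQ_cancel)
  apply (simp only: expand)
  apply (simp only: PQ_collect)
  apply (rule arg_cong[where f = "combination PQ_monomials"])
  apply (simp add: algebra_simps)
  done

theorem commutator_A_commutator_AB:
  "commutator A (commutator A B) = - 6 * B^2 + \<phi> b1 * anticommutator A B + \<phi> b2 * A^2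
    + \<phi> c4 * B + \<phi> c5 * A + \<phi> c8"
proof -
  have "commutator A (commutator A B) = 8 \<cdot> (P * C - C * P)"
    unfolding commutator_AB unfolding A_eq commutator_def
    by (simp add: smul_mult mult_smul smul_smul smul_add smul_diff algebra_simps)
  \<comment> \<open>The leading coefficient arises from \<open>8 * (-3) = (-6) * 2^2\<close>, as
    \<open>B\<close> has leading part \<open>2 \<cdot> Q\<close>.\<close>
  also have "\<dots> = (-6) \<cdot> (B * B) + b1 \<cdot> (A * B + B * A) + b2 \<cdot> (A * A) + c4 \<cdot> B + c5 \<cdot> A + c8 \<cdot> 1"
    unfolding commutator_P_C A_eq B_eq bc_defs
    apply (rule PQ_cancel)
    apply (simp only: expand)
    apply (simp only: PQ_collect)
    apply (rule arg_cong[where f = "combination PQ_monomials"])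
    apply (simp add: algebra_simps eval_nat_numeral)
    done
  finally show ?thesis
    by (simp add: smul_def \<phi>_minus \<phi>_numeral anticommutator_def power2_eq_square)
qed

theorem commutator_B_commutator_AB:
  "commutator B (commutator A B) = - 2 * A^3 - \<phi> b1 * B^2 - \<phi> b2 * anticommutator A B
    + \<phi> c3 * A^2 - \<phi> c5 * B + \<phi> c6 * A + \<phi> c9"
proof -
  \<comment> \<open>The summand \<open>(2 * s) \<cdot> P\<close> of \<open>B\<close> brings in the
    first relation as well. The cubic coefficient arises from
    \<open>8 * (-2) = (-2) * 2^3\<close>.\<close>
  have "commutator B (commutator A B) = 8 \<cdot> (Q * C - C * Q) + (8 * s) \<cdot> (P * C - C * P)"
    unfolding commutator_AB unfolding B_eq commutator_def
    by (simp add: smul_mult mult_smul smul_smul smul_add smul_diff algebra_simps)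
  also have "\<dots> = (-2) \<cdot> (A * A * A) - b1 \<cdot> (B * B) - b2 \<cdot> (A * B + B * A) + c3 \<cdot> (A * A)
      - c5 \<cdot> B + c6 \<cdot> A + c9 \<cdot> 1"
    unfolding commutator_P_C commutator_Q_C A_eq B_eq bc_defs
    apply (rule PQ_cancel)
    apply (simp only: expand)
    apply (simp only: PQ_collect)
    apply (rule arg_cong[where f = "combination PQ_monomials"])
    apply (simp add: algebra_simps eval_nat_numeral)
    done
  finally show ?thesis
    by (simp add: smul_def \<phi>_minus \<phi>_numeral anticommutator_def power2_eq_square
        power3_eq_cube mult.assoc)
qed

end

section \<open>Specialisation to the Racah algebra\<close>

theorem mainTheorem9:
  shows "\<exists>p1 p2 p3 p4 p5 p6 p8 p9 :: param_poly.
    \<forall>z0 z1 z2 z3 z4 :: complex.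
      let A = elemA z0 z1 z2;
          B = elemB z1 z2 z3 z4;
          C = commutator A B;
          ev = (\<lambda>p. eval_param_poly p z0 z1 z2 z3 z4);
          a0 = - 6; a0' = - 2;
          a1 = ev p1; a2 = ev p2; a3 = ev p3; a4 = ev p4;
          a5 = ev p5; a6 = ev p6; a8 = ev p8; a9 = ev p9
      in commutator A C =
           a0 * B^2 + a1 * anticommutator A B + a2 * A^2 + a4 * B + a5 * A + a8 \<and>
         commutator B C =
           a0' * A^3 - a1 * B^2 - a2 * anticommutator A B + a3 * A^2 - a5 * B + a6 * A + a9"
proof -
  \<comment> \<open>Complex coefficients allow halving the variables, as the substitutions
    \<open>z1 = 2 * u\<close>, \<open>z2 = 2 * v\<close>, \<open>z4 = 2 * s\<close> require.\<close>
  define half :: param_poly where "half = Poly_Mapping.single 0 (1 / 2)"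
  define d e1 e2 g r t u v s where vars: "d = var Vd" "e1 = var Ve1" "e2 = var Ve2" "g = var VGamma"
    "r = var Vz0" "t = var Vz3" "u = half * var Vz1" "v = half * var Vz2" "s = half * var Vz4"
  have "2 * half = 1"
    by (simp add: half_def mult_2 flip: single_add)
  then have double_vars: "2 * u = var Vz1" "2 * v = var Vz2" "2 * s = var Vz4"
    by (simp_all add: vars mult.assoc[symmetric])
  \<comment> \<open>The witnesses \<open>b1\<close>, \<open>b2\<close>, \<open>c3\<close>, ...,
    \<open>c9\<close> are formed as polynomials before the complex parameters are fixed; evaluation
    enters only with \<open>racah_triple\<close>.\<close>
  interpret racah_scalars d e1 e2 g u v r s t .
  show ?thesis
  proof (intro exI allI)
    fix z0 z1 z2 z3 z4 :: complex
    let ?\<phi> = "\<lambda>p. eval_param_poly p z0 z1 z2 z3 z4"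
    note hom = eval_param_poly_add eval_param_poly_mult eval_param_poly_1
    interpret racah_triple d e1 e2 g u v r s t ?\<phi> R1 R2 R3
      by unfold_locales
        (simp_all add: hom central_eval_param_poly vars eval_var racah_relations)
    have half: "?\<phi> half = racah_const (1 / 2)"
      by (simp add: half_def eval_param_poly_single scalar_value_def central_value_def)
    have A: "elemA z0 z1 z2 = A"
      unfolding elemA_def A_def scaleC_def double_vars by (simp add: vars eval_var)
    have "?\<phi> (2 * u * (u + s)) = racah_const (z1 * (z1 + z4) / 2)"
      unfolding double_vars unfolding vars hom eval_var half
      by (simp add: field_simps flip: racah_const_mult racah_const_add)
    moreover have "?\<phi> (2 * v * (v + s)) = racah_const (z2 * (z2 + z4) / 2)"
      unfolding double_vars unfolding vars hom eval_var half
      by (simp add: field_simps flip: racah_const_mult racah_const_add)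
    ultimately have B: "elemB z1 z2 z3 z4 = B"
      unfolding elemB_def B_def scaleC_def double_vars by (simp add: vars eval_var)
    show "let A = elemA z0 z1 z2;
          B = elemB z1 z2 z3 z4;
          C = commutator A B;
          ev = (\<lambda>p. eval_param_poly p z0 z1 z2 z3 z4);
          a0 = - 6; a0' = - 2;
          a1 = ev b1; a2 = ev b2; a3 = ev c3; a4 = ev c4;
          a5 = ev c5; a6 = ev c6; a8 = ev c8; a9 = ev c9
      in commutator A C =
           a0 * B^2 + a1 * anticommutator A B + a2 * A^2 + a4 * B + a5 * A + a8 \<and>
         commutator B C =
           a0' * A^3 - a1 * B^2 - a2 * anticommutator A B + a3 * A^2 - a5 * B + a6 * A + a9"
      unfolding Let_def A B
      by (rule conjI[OF commutator_A_commutator_AB commutator_B_commutator_AB])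
  qed
qed

end
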